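(* For any $\frac12\le p<1$ and any positive integer $k$, $$n_c(k,p)\ge\begin{cases}\dfrac{k}{2(1-p)}+1 & k\text{ even},\\[2mm] \dfrac{k+1}{2(1-p)} & k\text{ odd}.\end{cases}$$ Moreover, there is a (large) constant $C>0$ such that whenever $1-p=\frac1q$ for a prime-power $q$ and $k$ is a positive integer, $$n_c(k,p)\le C\,\frac{k}{1-p}\log\left(\frac1{1-p}\right).$$
   Context: $\mathcal{A}(n,k,p)$ is the set of all probability distributions $\mathbb{Q}$ of $n$ bits $(X_1,\ldots,X_n)\in\{0,1\}^n$ that are $k$-wise independent (every subset of at most $k$ of the bits is independent; fully independent if $k\ge n$) and satisfy $\mathbb{Q}(X_i=1)=p$ for all $i$. $m(n,k,p):=\min_{\mathbb{Q}\in\mathcal{A}(n,k,p)}\mathbb{Q}(\text{all bits are }1)$, and for $p\ge\frac12$, $n_c(k,p):=\min\{n : m(n,k,p)=0\}$ (with $\min\emptyset=\infty$). *)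

theory Defs
  imports "HOL-Probability.Probability" "HOL-Number_Theory.Prime_Powers"
begin

text \<open>
  An outcome \<open>\<omega>\<close> of \<open>n\<close> bits is a function in \<open>{..<n} \<rightarrow>\<^sub>E UNIV\<close>; bit \<open>i\<close> is \<open>\<omega> i\<close>, with
  \<open>True\<close> for \<open>1\<close>.
\<close>
definition kwise_dists :: "nat \<Rightarrow> nat \<Rightarrow> real \<Rightarrow> (nat \<Rightarrow> bool) pmf set" where
  "kwise_dists n k p = {Q.
     set_pmf Q \<subseteq> {..<n} \<rightarrow>\<^sub>E UNIV \<and>
     (\<forall>S. S \<subseteq> {..<n} \<and> card S \<le> k \<longrightarrow>
        prob_space.indep_vars (measure_pmf Q) (\<lambda>_. count_space UNIV) (\<lambda>i \<omega>. \<omega> i) S) \<and>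
     (\<forall>i<n. measure_pmf.prob Q {\<omega>. \<omega> i} = p)}"

definition min_all_ones :: "nat \<Rightarrow> nat \<Rightarrow> real \<Rightarrow> real" where
  "min_all_ones n k p = (INF Q\<in>kwise_dists n k p. measure_pmf.prob Q {\<omega>. \<forall>i<n. \<omega> i})"

text \<open>The infimum above is a minimum, by compactness.\<close>
lemma min_all_ones_attained:
  assumes "0 \<le> p" "p \<le> 1"
  shows "\<exists>Q\<in>kwise_dists n k p. measure_pmf.prob Q {\<omega>. \<forall>i<n. \<omega> i} = min_all_ones n k p"
proof -
  define \<Omega> where "\<Omega> = ({..<n} \<rightarrow>\<^sub>E (UNIV :: bool set))"
  have fin: "finite \<Omega>" unfolding \<Omega>_def by (intro finite_PiE) auto
  define P where "P f E = (\<Sum>\<omega>\<in>\<Omega>. if \<omega> \<in> E then f \<omega> else 0)" 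
    for f :: "(nat \<Rightarrow> bool) \<Rightarrow> real" and E
  have P: "measure_pmf.prob Q E = P (pmf Q) E" if "set_pmf Q \<subseteq> \<Omega>" for Q E
  proof -
    have "measure_pmf.prob Q E = measure_pmf.prob Q (\<Omega> \<inter> E)"
      using that by (intro measure_prob_cong_0) (auto simp: set_pmf_iff)
    also have "\<dots> = sum (pmf Q) (\<Omega> \<inter> E)"
      using fin by (simp add: measure_measure_pmf_finite)
    also have "\<dots> = P (pmf Q) E"
      unfolding P_def using fin by (simp add: sum.inter_restrict)
    finally show ?thesis .
  qed
  have cont: "continuous_on UNIV (\<lambda>f. P f E)" for E
  proof -
    have "continuous_on UNIV (\<lambda>f :: (nat \<Rightarrow> bool) \<Rightarrow> real. if \<omega> \<in> E then f \<omega> else 0)" for \<omega>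
      by (cases "\<omega> \<in> E") auto
    then show ?thesis unfolding P_def by (intro continuous_on_sum)
  qed
  define F :: "nat \<Rightarrow> (nat \<Rightarrow> bool) set set"
    where "F i = {(\<lambda>\<omega>. \<omega> i) -` A \<inter> UNIV | A. A \<in> UNIV}" for i
  define C where "C = (\<Pi>\<^sub>E \<omega>\<in>UNIV. if \<omega> \<in> \<Omega> then {0..1::real} else {0})"
  define D where "D = {f. P f UNIV = 1 \<and>
      (\<forall>S. S \<subseteq> {..<n} \<and> card S \<le> k \<longrightarrow> (\<forall>J. J \<subseteq> S \<longrightarrow> J \<noteq> {} \<longrightarrow> finite J \<longrightarrow>
         (\<forall>A. A \<in> Pi J F \<longrightarrow> P f (\<Inter>j\<in>J. A j) = (\<Prod>j\<in>J. P f (A j))))) \<and>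
      (\<forall>i. i < n \<longrightarrow> P f {\<omega>. \<omega> i} = p)}"
  have "compactin (product_topology (\<lambda>_. euclidean) UNIV) C"
    unfolding C_def compactin_PiE by auto
  then have compC: "compact C" by (simp add: euclidean_product_topology)
  have "closed D" unfolding D_def
    by (intro closed_Collect_conj closed_Collect_all closed_Collect_imp closed_Collect_eq
        continuous_on_prod cont continuous_on_const open_Collect_const)
  with compC have compK: "compact (C \<inter> D)" by (rule compact_Int_closed)
  have inA: "Q \<in> kwise_dists n k p \<longleftrightarrow> set_pmf Q \<subseteq> \<Omega> \<and> pmf Q \<in> D" for Q
  proof (cases "set_pmf Q \<subseteq> \<Omega>")
    case True
    have "P (pmf Q) UNIV = 1" using P[OF True, of UNIV] by simp
    moreover have "prob_space.indep_vars Q (\<lambda>_. count_space UNIV) (\<lambda>i \<omega>. \<omega> i) S \<longleftrightarrow>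
        (\<forall>J. J \<subseteq> S \<longrightarrow> J \<noteq> {} \<longrightarrow> finite J \<longrightarrow>
         (\<forall>A. A \<in> Pi J F \<longrightarrow> P (pmf Q) (\<Inter>j\<in>J. A j) = (\<Prod>j\<in>J. P (pmf Q) (A j))))" for S
    proof -
      have "prob_space.indep_vars Q (\<lambda>_. count_space UNIV) (\<lambda>i \<omega>. \<omega> i) S \<longleftrightarrow>
          prob_space.indep_sets Q F S"
        unfolding prob_space.indep_vars_def2[OF prob_space_measure_pmf] F_def by simp
      then show ?thesis
        unfolding prob_space.indep_sets_def[OF prob_space_measure_pmf] P[OF True]
        by (simp add: Ball_def)
    qed
    ultimately show ?thesis using True
      unfolding kwise_dists_def D_def mem_Collect_eq \<Omega>_def[symmetric] P[OF True] by simp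
  qed (auto simp: kwise_dists_def \<Omega>_def)
  have pmfC: "pmf Q \<in> C" if "set_pmf Q \<subseteq> \<Omega>" for Q
    using that by (auto simp: C_def pmf_le_1 set_pmf_iff)
  have ex: "\<exists>Q\<in>kwise_dists n k p. pmf Q = f" if f: "f \<in> C \<inter> D" for f
  proof -
    have *: "f \<omega> \<in> (if \<omega> \<in> \<Omega> then {0..1} else {0})" for \<omega>
      using f unfolding C_def by (intro PiE_mem[of f UNIV]) auto
    have nn: "0 \<le> f \<omega>" for \<omega> using *[of \<omega>] by (auto split: if_splits)
    have z: "f \<omega> = 0" if "\<omega> \<notin> \<Omega>" for \<omega> using *[of \<omega>] that by simp
    have "(\<integral>\<^sup>+ \<omega>. ennreal (f \<omega>) \<partial>count_space UNIV) = (\<Sum>\<omega>\<in>\<Omega>. ennreal (f \<omega>))"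
      using z fin by (intro nn_integral_count_space') auto
    also have "\<dots> = ennreal (P f UNIV)" by (simp add: P_def sum_ennreal nn)
    also have "\<dots> = 1" using f by (simp add: D_def)
    finally have e: "pmf (embed_pmf f) = f" using nn by (intro ext pmf_embed_pmf) auto
    then have "set_pmf (embed_pmf f) \<subseteq> \<Omega>" using z by (auto simp: set_pmf_eq)
    with e f show ?thesis by (intro bexI[of _ "embed_pmf f"]) (auto simp: inA)
  qed
  have "Pi_pmf {..<n} undefined (\<lambda>_. bernoulli_pmf p) \<in> kwise_dists n k p" (is "?B \<in> _")
  proof -
    have "set_pmf ?B \<subseteq> {..<n} \<rightarrow>\<^sub>E UNIV"
      by (rule order_trans[OF set_Pi_pmf_subset']) (auto simp: PiE_dflt_def)
    moreover have "prob_space.indep_vars ?B (\<lambda>_. count_space UNIV) (\<lambda>i \<omega>. \<omega> i) S"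
      if "S \<subseteq> {..<n}" for S
      by (rule prob_space.indep_vars_subset[OF prob_space_measure_pmf indep_vars_Pi_pmf that]) simp
    moreover have "measure_pmf.prob ?B {\<omega>. \<omega> i} = p" if "i < n" for i
    proof -
      have "measure_pmf.prob (map_pmf (\<lambda>\<omega>. \<omega> i) ?B) {True} = p"
        using that assms by (simp add: Pi_pmf_component measure_pmf_single)
      then show ?thesis by (simp add: vimage_def)
    qed
    ultimately show ?thesis by (auto simp: kwise_dists_def)
  qed
  then have "C \<inter> D \<noteq> {}" using pmfC inA by blast
  then obtain f where f: "f \<in> C \<inter> D"
    and min: "\<And>g. g \<in> C \<inter> D \<Longrightarrow> P f {\<omega>. \<forall>i<n. \<omega> i} \<le> P g {\<omega>. \<forall>i<n. \<omega> i}"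
    using continuous_attains_inf[OF compK _ continuous_on_subset[OF cont subset_UNIV]] by blast
  obtain Q where Q: "Q \<in> kwise_dists n k p" "pmf Q = f" using ex[OF f] by blast
  have "measure_pmf.prob Q {\<omega>. \<forall>i<n. \<omega> i} = min_all_ones n k p"
    unfolding min_all_ones_def
  proof (rule sym, rule cInf_eq_minimum)
    show "measure_pmf.prob Q {\<omega>. \<forall>i<n. \<omega> i} \<in>
        (\<lambda>Q. measure_pmf.prob Q {\<omega>. \<forall>i<n. \<omega> i}) ` kwise_dists n k p" using Q by blast
    fix x assume "x \<in> (\<lambda>Q. measure_pmf.prob Q {\<omega>. \<forall>i<n. \<omega> i}) ` kwise_dists n k p"
    then obtain R where R: "R \<in> kwise_dists n k p" "x = measure_pmf.prob R {\<omega>. \<forall>i<n. \<omega> i}" by blast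
    show "measure_pmf.prob Q {\<omega>. \<forall>i<n. \<omega> i} \<le> x"
      using min[of "pmf R"] Q R pmfC by (simp add: inA P)
  qed
  with Q show ?thesis by blast
qed

text \<open>The infimum of the empty set is \<open>\<infinity>\<close>, and otherwise it is the least element.\<close>
definition n_c :: "nat \<Rightarrow> real \<Rightarrow> enat" where
  "n_c k p = Inf {enat n | n. min_all_ones n k p = 0}"

end

theory Submission imports Defs begin

text \<open>
  Write \<open>d = 1 - p\<close> and let \<open>S\<close> be the number of zero bits, whose moments up to order \<open>k\<close> are those
  of the binomial distribution.

  Lower bound. Let \<open>k = 2 m - 1\<close> and \<open>n d < m\<close>. The smallest root of the \<open>m\<close>-th Krawtchouk polynomial
  is then below \<open>1\<close>, so by Gauss quadrature some polynomial \<open>R\<close> of degree below \<open>m\<close> has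
  \<open>E (R(S)\<^sup>2 (1 - S)) > 0\<close>, which is impossible if \<open>S \<ge> 1\<close> almost surely. For even \<open>k\<close>, condition on one
  bit being \<open>1\<close>; this lowers both \<open>n\<close> and \<open>k\<close> by \<open>1\<close>.

  Upper bound. By the argument of Caratheodory's theorem there is a \<open>k\<close>-wise independent distribution
  of words in \<open>{0, ..., q - 1}\<^sup>n\<close>, uniform in each letter, whose support has at most
  \<open>D = \<Sum>j\<le>k. (n choose j) q ^ j\<close> words. If \<open>D (1 - 1/q) ^ n < 1\<close>, a union bound gives a word \<open>a\<close>
  that agrees with each word of the support in at least one place; let the bit \<open>i\<close> of \<open>y\<close> be zero
  iff \<open>y i = a i\<close>.
\<close>

section \<open>Krawtchouk polynomials and the binomial distribution\<close>

lemma sum_alternating_choose: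
  fixes f :: "nat \<Rightarrow> real"
  shows "(\<Sum>j\<le>Suc m. (-1) ^ j * real (Suc m choose j) * f j)
    = (\<Sum>j\<le>m. (-1) ^ j * real (m choose j) * (f j - f (Suc j)))"
proof -
  have "(\<Sum>j\<le>Suc m. (-1) ^ j * real (Suc m choose j) * f j)
      = f 0 - (\<Sum>j\<le>m. (-1) ^ j * real (Suc m choose Suc j) * f (Suc j))"
    by (subst sum.atMost_Suc_shift) (simp add: sum_negf)
  also have "(\<Sum>j\<le>m. (-1) ^ j * real (Suc m choose Suc j) * f (Suc j))
      = (\<Sum>j\<le>m. (-1) ^ j * real (m choose j) * f (Suc j))
        + (\<Sum>j\<le>m. (-1) ^ j * real (m choose Suc j) * f (Suc j))"
    by (simp add: sum.distrib [symmetric] algebra_simps)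
  also have "(\<Sum>j\<le>m. (-1) ^ j * real (m choose Suc j) * f (Suc j))
      = f 0 - (\<Sum>j\<le>Suc m. (-1) ^ j * real (m choose j) * f j)"
    by (subst sum.atMost_Suc_shift) (simp add: sum_negf)
  also have "(\<Sum>j\<le>Suc m. (-1) ^ j * real (m choose j) * f j)
      = (\<Sum>j\<le>m. (-1) ^ j * real (m choose j) * f j)"
    by (simp add: binomial_eq_0)
  finally show ?thesis by (simp add: sum_subtractf algebra_simps)
qed

text \<open>Up to sign, the sum is an \<open>m\<close>-th finite difference of
  \<open>(n - j) choose i\<close>, a polynomial in \<open>j\<close> of degree \<open>i < m\<close>.
  Each difference lowers \<open>n\<close> and \<open>i\<close> by one; \<open>m \<le> n\<close>
  keeps the truncated subtraction \<open>n - j\<close> exact.\<close>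

lemma sum_alternating_choose_choose_eq_0:
  assumes "i < m" "m \<le> n"
  shows "(\<Sum>j\<le>m. (-1) ^ j * real (m choose j) * real ((n - j) choose i)) = 0"
  using assms
proof (induction m arbitrary: n i)
  case (Suc m)
  have *: "real ((n - j) choose i) - real ((n - Suc j) choose i)
      = (if i = 0 then 0 else real ((n - 1 - j) choose (i - 1)))" if "j \<le> m" for j
  proof (cases i)
    case (Suc i')
    have "n - j = Suc (n - Suc j)" "n - 1 - j = n - Suc j" using that Suc.prems by auto
    then show ?thesis using Suc by simp
  qed simp
  show ?case
  proof (cases i)
    case 0
    then show ?thesis unfolding sum_alternating_choose using * by simp
  next
    case (Suc i')
    then show ?thesis unfolding sum_alternating_choose
      using * Suc.IH[of i' "n - 1"] Suc.prems by simp
  qed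
qed simp

section \<open>Moments of the binomial distribution\<close>

definition binomial_mean :: "nat \<Rightarrow> real \<Rightarrow> (nat \<Rightarrow> real) \<Rightarrow> real" where
  "binomial_mean n d f = (\<Sum>s\<le>n. real (n choose s) * d ^ s * (1 - d) ^ (n - s) * f s)"

text \<open>For \<open>s\<close> successes in \<open>n\<close> independent trials of success
  probability \<open>d\<close>, both sides are the expected number of pairs of disjoint sets of
  trials, \<open>j\<close> of them all successes and \<open>i\<close> all failures. The proof is
  algebraic.\<close>

lemma binomial_mean_choose_choose:
  "binomial_mean n d (\<lambda>s. real (s choose j) * real ((n - s) choose i))
    = real (n choose j) * real ((n - j) choose i) * d ^ j * (1 - d) ^ i"
proof (cases "j + i \<le> n")
  case True
  \<comment> \<open>Both sides count the choices of \<open>t + j\<close> successes with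
    \<open>j\<close> of them marked, and of \<open>i\<close> marked failures.\<close>
  have eq: "(n choose (t + j)) * ((t + j) choose j) * ((n - (t + j)) choose i)
      = (n choose j) * ((n - j) choose i) * ((n - j - i) choose t)" if "t \<le> n - j - i" for t
  proof -
    have "(n choose (t + j)) * ((t + j) choose j) = (n choose j) * ((n - j) choose t)"
      using that True choose_mult[of j "t + j" n] by simp
    moreover have "((n - j) choose t) * ((n - (t + j)) choose i)
        = ((n - j) choose (t + i)) * ((t + i) choose t)"
      using that True choose_mult[of t "t + i" "n - j"] by (simp add: add.commute)
    moreover have "((n - j) choose (t + i)) * ((t + i) choose i)
        = ((n - j) choose i) * ((n - j - i) choose t)"
      using that True choose_mult[of i "t + i" "n - j"] by simp
    moreover have "((t + i) choose t) = ((t + i) choose i)"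
      using binomial_symmetric[of t "t + i"] by simp
    ultimately show ?thesis by (metis mult.assoc)
  qed
  \<comment> \<open>Only \<open>j \<le> s \<le> n - i\<close> contributes; put
    \<open>s = t + j\<close>. After the constant factor is pulled out, the sum over \<open>t\<close>
    is the total mass of a binomial distribution on \<open>n - j - i\<close> trials.\<close>
  have "binomial_mean n d (\<lambda>s. real (s choose j) * real ((n - s) choose i))
      = (\<Sum>s\<in>{0 + j..n - j - i + j}. real (n choose s) * d ^ s * (1 - d) ^ (n - s)
           * (real (s choose j) * real ((n - s) choose i)))"
    unfolding binomial_mean_def
    by (rule sum.mono_neutral_right) (use True in \<open>auto simp: binomial_eq_0_iff\<close>)
  also have "\<dots> = (\<Sum>t\<le>n - j - i. real (n choose (t + j)) * d ^ (t + j) * (1 - d) ^ (n - (t + j))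
           * (real ((t + j) choose j) * real ((n - (t + j)) choose i)))"
    by (subst sum.shift_bounds_cl_nat_ivl) (simp add: atLeast0AtMost)
  also have "\<dots> = (\<Sum>t\<le>n - j - i. (real (n choose j) * real ((n - j) choose i) * d ^ j * (1 - d) ^ i)
           * (real ((n - j - i) choose t) * d ^ t * (1 - d) ^ (n - j - i - t)))"
  proof (rule sum.cong)
    fix t assume "t \<in> {..n - j - i}"
    then have t: "t \<le> n - j - i" by simp
    then have e: "n - (t + j) = i + (n - j - i - t)" using True by simp
    have "real (n choose (t + j)) * real ((t + j) choose j) * real ((n - (t + j)) choose i)
      = real (n choose j) * real ((n - j) choose i) * real ((n - j - i) choose t)"
      using eq[OF t] by (metis of_nat_mult)
    moreover have "(1 - d) ^ (n - (t + j)) = (1 - d) ^ i * (1 - d) ^ (n - j - i - t)"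
      by (subst e) (simp add: power_add)
    ultimately show "real (n choose (t + j)) * d ^ (t + j) * (1 - d) ^ (n - (t + j))
           * (real ((t + j) choose j) * real ((n - (t + j)) choose i))
         = (real (n choose j) * real ((n - j) choose i) * d ^ j * (1 - d) ^ i)
           * (real ((n - j - i) choose t) * d ^ t * (1 - d) ^ (n - j - i - t))"
      by (simp add: power_add)
  qed simp
  also have "\<dots> = (real (n choose j) * real ((n - j) choose i) * d ^ j * (1 - d) ^ i) * (d + (1 - d)) ^ (n - j - i)"
    by (simp only: binomial_ring sum_distrib_left)
  finally show ?thesis by simp
next
  case False
  then have "real (s choose j) * real ((n - s) choose i) = 0" if "s \<le> n" for s
    using that by (cases "s < j") (auto simp: binomial_eq_0_iff)
  moreover have "real (n choose j) * real ((n - j) choose i) = 0"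
    using False by (cases "n < j") (auto simp: binomial_eq_0_iff)
  moreover have "binomial_mean n d (\<lambda>s. real (s choose j) * real ((n - s) choose i)) = 0"
    unfolding binomial_mean_def by (intro sum.neutral ballI) (use calculation(1) in \<open>simp del: mult_eq_0_iff\<close>)
  ultimately show ?thesis by simp
qed

text \<open>Binomial coefficients are the basis in which the moments of the zero count are known, so
  a bound on the degree becomes a bound on the order of the moments used. Induction on the
  coefficients of \<open>f\<close> reduces everything to the action of multiplication by
  \<open>s\<close> on this basis.\<close>

lemma poly_newton_expansion:
  fixes f :: "real poly"
  assumes "degree f \<le> k"
  obtains a where "\<And>s. poly f (real s) = (\<Sum>j\<le>k. a j * real (s choose j))"
proof -
  have "\<exists>a. \<forall>s. poly f (real s) = (\<Sum>j\<le>k. a j * real (s choose j))"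
    using assms
  proof (induction f arbitrary: k)
    case 0
    then show ?case by (intro exI[of _ "\<lambda>_. 0"]) simp
  next
    case (pCons c f)
    show ?case
    proof (cases "f = 0")
      case True
      have "(\<Sum>j\<le>k. (if j = 0 then c else 0) * real (s choose j)) = c" for s
        using sum.delta[of "{..k}" 0 "\<lambda>j. c * real (s choose j)"]
        by (simp add: if_distrib[of "\<lambda>x. x * _"] cong: if_cong)
      then show ?thesis using True by (intro exI[of _ "\<lambda>j. if j = 0 then c else 0"]) simp
    next
      case False
      then obtain l where k: "k = Suc l" "degree f \<le> l" using pCons.prems by (cases k) auto
      with pCons.IH obtain a where a: "\<And>s. poly f (real s) = (\<Sum>j\<le>l. a j * real (s choose j))"
        by blast
      \<comment> \<open>Coefficients of \<open>c + s * f(s)\<close>, read off from the identity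
        \<open>mult\<close> below. The values of \<open>a\<close> above \<open>l\<close> are
        unspecified, hence the test \<open>i < l\<close>.\<close>
      define b where "b j = (case j of 0 \<Rightarrow> c
          | Suc i \<Rightarrow> real (Suc i) * (a i + (if i < l then a (Suc i) else 0)))" for j
      have mult: "real s * real (s choose j)
          = real (Suc j) * real (s choose Suc j) + real j * real (s choose j)" for s j
      proof (cases "j \<le> s")
        case True
        then have "(s choose j) * (s - j) = Suc j * (s choose Suc j)"
          by (metis binomial_absorb_comp binomial_absorption diff_Suc_1 mult.commute)
        then have "(real s - real j) * real (s choose j) = real (Suc j) * real (s choose Suc j)"
          using True by (metis mult.commute of_nat_diff of_nat_mult)
        then show ?thesis by (simp add: algebra_simps)
      qed (simp add: binomial_eq_0)
      have "poly (pCons c f) (real s) = (\<Sum>j\<le>k. b j * real (s choose j))" for s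
      proof -
        \<comment> \<open>\<open>h\<close> collects the terms \<open>j * a j * (s choose j)\<close>,
          cut off above \<open>l\<close>. It vanishes at \<open>0\<close> and at
          \<open>Suc l\<close>, so its sum may be shifted by one.\<close>
        define h where "h j = real j * (if j \<le> l then a j else 0) * real (s choose j)" for j
        have "(\<Sum>j\<le>l. h j) = (\<Sum>j\<le>Suc l. h j)" by (simp add: h_def)
        also have "\<dots> = (\<Sum>j\<le>l. h (Suc j))"
          by (subst sum.atMost_Suc_shift) (simp add: h_def)
        finally have h: "(\<Sum>j\<le>l. h j) = (\<Sum>j\<le>l. h (Suc j))" .
        have "(\<Sum>j\<le>k. b j * real (s choose j))
            = c + (\<Sum>j\<le>l. b (Suc j) * real (s choose Suc j))"
          unfolding k by (subst sum.atMost_Suc_shift) (simp add: b_def)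
        also have "(\<Sum>j\<le>l. b (Suc j) * real (s choose Suc j))
            = (\<Sum>j\<le>l. a j * (real (Suc j) * real (s choose Suc j)) + h (Suc j))"
          by (rule sum.cong) (auto simp: b_def h_def algebra_simps)
        also have "\<dots> = (\<Sum>j\<le>l. a j * (real (Suc j) * real (s choose Suc j)) + h j)"
          by (simp only: sum.distrib h)
        also have "\<dots> = (\<Sum>j\<le>l. real s * (a j * real (s choose j)))"
        proof (rule sum.cong)
          fix j assume "j \<in> {..l}"
          then have "a j * (real (Suc j) * real (s choose Suc j)) + h j
              = a j * (real (Suc j) * real (s choose Suc j) + real j * real (s choose j))"
            by (simp add: h_def distrib_left)
          then show "a j * (real (Suc j) * real (s choose Suc j)) + h j
              = real s * (a j * real (s choose j))"
            by (simp only: mult [symmetric] mult.left_commute)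
        qed simp
        finally show ?thesis using a by (simp add: sum_distrib_left)
      qed
      then show ?thesis by blast
    qed
  qed
  then show ?thesis using that by blast
qed


lemma binomial_mean_sum:
  "binomial_mean n d (\<lambda>s. \<Sum>j\<in>A. f j s) = (\<Sum>j\<in>A. binomial_mean n d (f j))"
  unfolding binomial_mean_def by (subst sum.swap) (simp add: sum_distrib_left)

lemma binomial_mean_mult_left:
  "binomial_mean n d (\<lambda>s. c * f s) = c * binomial_mean n d f"
  unfolding binomial_mean_def by (simp add: sum_distrib_left mult_ac)

lemma binomial_mean_add:
  "binomial_mean n d (\<lambda>s. f s + g s) = binomial_mean n d f + binomial_mean n d g"
  unfolding binomial_mean_def by (simp add: sum.distrib distrib_left)

lemma binomial_mean_cong:
  "(\<And>s. s \<le> n \<Longrightarrow> f s = g s) \<Longrightarrow> binomial_mean n d f = binomial_mean n d g"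
  unfolding binomial_mean_def by simp

text \<open>Only the term \<open>s = 0\<close> is kept. Its weight is positive when
  \<open>d < 1\<close>, which is the source of strict positivity below.\<close>

lemma binomial_mean_ge_at_0:
  assumes "0 \<le> d" "d \<le> 1" "\<And>s. 0 \<le> f s"
  shows "(1 - d) ^ n * f 0 \<le> binomial_mean n d f"
  unfolding binomial_mean_def
  using member_le_sum[of 0 "{..n}" "\<lambda>s. real (n choose s) * d ^ s * (1 - d) ^ (n - s) * f s"] assms
  by simp

lemma poly_exists_choose:
  obtains g :: "real poly"
  where "degree g \<le> j" "\<And>s. poly g (real s) = real (s choose j)"
proof
  define g :: "real poly" where "g = smult (1 / fact j) (\<Prod>i<j. [:- of_nat i, 1:])"
  have "degree (\<Prod>i<j. [:- real i, 1:]) \<le> (\<Sum>i<j. degree [:- real i, 1:])"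
    using degree_prod_sum_le[of "{..<j}" "\<lambda>i. [:- real i, 1:]"] by (simp add: o_def)
  then show "degree g \<le> j" by (simp add: g_def)
  show "poly g (real s) = real (s choose j)" for s
    by (simp add: g_def poly_prod binomial_gbinomial gbinomial_prod_rev atLeast0LessThan)
qed

text \<open>
  \<open>K\<close> below is the Krawtchouk polynomial of degree \<open>m\<close> with \<open>K(0) = 1\<close>. Its value
  \<open>K(1) = 1 - m / (n d)\<close> is negative, so it has a root \<open>x\<close> in \<open>(0, 1)\<close>, and
  \<open>R = K / (s - x)\<close> works because \<open>K\<close> is orthogonal to \<open>R\<close>.
\<close>
lemma binomial_mean_square_times_one_minus_pos:
  fixes d :: real
  assumes d: "0 < d" "d < 1" and n: "real n * d < real m"
  obtains R :: "real poly"
  where "degree R < m" "0 < binomial_mean n d (\<lambda>s. (poly R (real s))\<^sup>2 * (1 - real s))"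
proof (cases "n < m")
  case True
  \<comment> \<open>With at most \<open>m\<close> points in \<open>{0..n}\<close>, interpolation
    suffices: \<open>R\<close> is \<open>1\<close> at \<open>0\<close> and \<open>0\<close> at
    \<open>1, ..., n\<close>, and the mean is the mass at \<open>0\<close>.\<close>
  define R :: "real poly" where "R = (\<Prod>i\<in>{1..n}. [:1, - (1 / real i):])"
  have R: "poly R (real s) = (if s = 0 then 1 else 0)" if "s \<le> n" for s
    using that by (auto simp: R_def poly_prod)
  have "degree R \<le> (\<Sum>i\<in>{1..n}. degree [:1, - (1 / real i):])"
    using degree_prod_sum_le[of "{1..n}" "\<lambda>i. [:1, - (1 / real i):]"] by (simp add: R_def o_def)
  also have "\<dots> \<le> (\<Sum>i\<in>{1..n}. 1)" by (intro sum_mono) simp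
  finally have "degree R < m" using True by simp
  moreover have "binomial_mean n d (\<lambda>s. (poly R (real s))\<^sup>2 * (1 - real s))
      = binomial_mean n d (\<lambda>s. if s = 0 then 1 else 0)"
    by (rule binomial_mean_cong) (simp add: R)
  moreover have "(1 - d) ^ n * 1 \<le> binomial_mean n d (\<lambda>s. if s = 0 then 1 else 0)"
    using binomial_mean_ge_at_0[of d "\<lambda>s. if s = 0 then 1 else 0" n] d by simp
  moreover have "0 < (1 - d) ^ n" using d by simp
  ultimately show ?thesis using that[of R] by simp
next
  case False
  then have mn: "m \<le> n" by simp
  have m0: "0 < m" using n d by (cases m) (auto simp: mult_less_0_iff)
  have "\<forall>j. \<exists>g :: real poly. degree g \<le> j \<and> (\<forall>s. poly g (real s) = real (s choose j))"
    using poly_exists_choose by metis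
  then obtain G :: "nat \<Rightarrow> real poly"
    where G: "\<And>j. degree (G j) \<le> j" "\<And>j s. poly (G j) (real s) = real (s choose j)"
    by metis
  \<comment> \<open>The denominators cancel the factor \<open>(n choose j) * d ^ j\<close> of the
    mixed moments, so that only alternating binomial sums remain in \<open>orth\<close>;
    \<open>m \<le> n\<close> keeps them nonzero.\<close>
  define c where "c j = (- 1) ^ j * real (m choose j) / (real (n choose j) * d ^ j)" for j
  define K where "K = (\<Sum>j\<le>m. smult (c j) (G j))"
  have K: "poly K (real s) = (\<Sum>j\<le>m. c j * real (s choose j))" for s
    by (simp add: K_def poly_sum G)
  have "poly K (real 0) = 1" unfolding K by (subst sum.atMost_shift) (simp add: c_def)
  then have K0: "poly K 0 = 1" by simp
  have "poly K (real 1) = c 0 + c 1"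
  proof -
    have "poly K (real 1) = (\<Sum>j\<in>{0, 1}. c j * real (1 choose j))"
      unfolding K by (rule sum.mono_neutral_right) (use m0 in auto)
    then show ?thesis by simp
  qed
  also have "\<dots> = 1 - real m / (real n * d)" by (simp add: c_def)
  also have "\<dots> < 0" using n d m0 mn by (simp add: field_simps)
  finally have K1: "poly K 1 < 0" by simp
  obtain x where x: "0 < x" "x < 1" "poly K x = 0"
    using poly_IVT_neg[of 0 1 K] K0 K1 by auto
  then obtain R where KR: "K = [:- x, 1:] * R" by (auto simp: poly_eq_0_iff_dvd)
  have "degree (smult (c j) (G j)) \<le> m" if "j \<le> m" for j
    using degree_smult_le[of "c j" "G j"] G(1)[of j] that by linarith
  then have "degree K \<le> m" unfolding K_def by (intro degree_sum_le) auto
  moreover have "R \<noteq> 0" using KR K0 by auto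
  then have "degree K = Suc (degree R)" unfolding KR by (subst degree_mult_eq) auto
  ultimately have degR: "degree R < m" by simp
  have R0: "poly R 0 \<noteq> 0" using KR K0 by auto
  have orth: "binomial_mean n d (\<lambda>s. poly K (real s) * poly R (real s)) = 0"
  proof -
    \<comment> \<open>Expanding \<open>R\<close> in powers of \<open>n - s\<close> instead of
      \<open>s\<close> yields products \<open>(s choose j) * ((n - s) choose i)\<close> with known
      means. Since \<open>i \<le> m - 1\<close>, each inner sum over \<open>j\<close> is
      zero.\<close>
    define R' where "R' = pcompose R [:real n, - 1:]"
    have "degree R' \<le> m - 1"
      using degR by (simp add: R'_def degree_pcompose)
    then obtain b where b: "\<And>s. poly R' (real s) = (\<Sum>i\<le>m - 1. b i * real (s choose i))"
      using poly_newton_expansion by blast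
    have R: "poly R (real s) = (\<Sum>i\<le>m - 1. b i * real ((n - s) choose i))" if "s \<le> n" for s
      using b[of "n - s"] that by (simp add: R'_def poly_pcompose of_nat_diff)
    have "binomial_mean n d (\<lambda>s. poly K (real s) * poly R (real s))
        = binomial_mean n d (\<lambda>s. \<Sum>i\<le>m - 1. \<Sum>j\<le>m. (b i * c j) * (real (s choose j) * real ((n - s) choose i)))"
      by (rule binomial_mean_cong) (simp add: K R sum_product mult_ac, subst sum.swap, rule refl)
    also have "\<dots> = (\<Sum>i\<le>m - 1. \<Sum>j\<le>m. b i * c j * (real (n choose j) * real ((n - j) choose i) * d ^ j * (1 - d) ^ i))"
      by (simp only: binomial_mean_sum binomial_mean_mult_left binomial_mean_choose_choose)
    also have "\<dots> = (\<Sum>i\<le>m - 1. b i * (1 - d) ^ i * (\<Sum>j\<le>m. (- 1) ^ j * real (m choose j) * real ((n - j) choose i)))"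
      unfolding sum_distrib_left
      by (intro sum.cong refl) (use mn d in \<open>auto simp: c_def\<close>)
    also have "\<dots> = 0"
      using mn m0 by (intro sum.neutral) (simp add: sum_alternating_choose_choose_eq_0)
    finally show ?thesis .
  qed
  \<comment> \<open>Use \<open>1 - s = (1 - x) - (s - x)\<close> and \<open>(s - x) * R = K\<close>;
    the term \<open>K * R\<close> has mean zero.\<close>
  have "binomial_mean n d (\<lambda>s. (poly R (real s))\<^sup>2 * (1 - real s))
      = binomial_mean n d (\<lambda>s. (1 - x) * (poly R (real s))\<^sup>2 + (- 1) * (poly K (real s) * poly R (real s)))"
    by (rule binomial_mean_cong) (simp add: KR power2_eq_square algebra_simps)
  also have "\<dots> = (1 - x) * binomial_mean n d (\<lambda>s. (poly R (real s))\<^sup>2)"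
    by (simp only: binomial_mean_add binomial_mean_mult_left orth)
  also have "\<dots> > 0"
  proof -
    have "(1 - d) ^ n * (poly R 0)\<^sup>2 \<le> binomial_mean n d (\<lambda>s. (poly R (real s))\<^sup>2)"
      using binomial_mean_ge_at_0[of d "\<lambda>s. (poly R (real s))\<^sup>2" n] d by simp
    moreover have "0 < (1 - d) ^ n * (poly R 0)\<^sup>2" using R0 d by simp
    ultimately show ?thesis using x by simp
  qed
  finally show ?thesis using that degR by blast
qed

section \<open>Weights on sets with binomial moments\<close>

text \<open>Double counting of the pairs \<open>J \<subseteq> Z\<close> with
  \<open>card J = j\<close>.\<close>

lemma sum_card_choose_eq:
  fixes w :: "'a set \<Rightarrow> real"
  assumes N: "finite N"
    and moment: "\<And>J. J \<subseteq> N \<Longrightarrow> card J = j \<Longrightarrow> (\<Sum>Z | J \<subseteq> Z \<and> Z \<subseteq> N. w Z) = d ^ j"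
  shows "(\<Sum>Z\<in>Pow N. w Z * real (card Z choose j)) = real (card N choose j) * d ^ j"
proof -
  have "(\<Sum>Z\<in>Pow N. w Z * real (card Z choose j)) = (\<Sum>Z\<in>Pow N. \<Sum>J | J \<subseteq> Z \<and> card J = j. w Z)"
    using N by (intro sum.cong refl) (auto simp: n_subsets finite_subset)
  also have "\<dots> = (\<Sum>J | J \<subseteq> N \<and> card J = j. \<Sum>Z | J \<subseteq> Z \<and> Z \<subseteq> N. w Z)"
  proof -
    have "(\<Sum>Z\<in>Pow N. \<Sum>J | J \<subseteq> Z \<and> card J = j. w Z)
        = (\<Sum>Z\<in>Pow N. \<Sum>J | J \<in> {J. J \<subseteq> N \<and> card J = j} \<and> J \<subseteq> Z. w Z)"
      by (intro sum.cong refl) auto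
    also have "\<dots> = (\<Sum>J | J \<subseteq> N \<and> card J = j. \<Sum>Z | Z \<in> Pow N \<and> J \<subseteq> Z. w Z)"
      using N by (intro sum.swap_restrict) auto
    finally show ?thesis by (simp add: conj_commute)
  qed
  also have "\<dots> = real (card N choose j) * d ^ j"
    using N by (simp add: moment n_subsets)
  finally show ?thesis .
qed

text \<open>In the application \<open>Z\<close> is the set of zero bits and \<open>w\<close> its
  law. The size of \<open>Z\<close> shares its factorial moments up to order \<open>k\<close> with
  the binomial distribution, and these determine the mean of every polynomial of degree at most
  \<open>k\<close>.\<close>

lemma sum_poly_card_eq_binomial_mean:
  fixes w :: "'a set \<Rightarrow> real"
  assumes N: "finite N"
    and moment: "\<And>J. J \<subseteq> N \<Longrightarrow> card J \<le> k \<Longrightarrow> (\<Sum>Z | J \<subseteq> Z \<and> Z \<subseteq> N. w Z) = d ^ card J"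
    and f: "degree f \<le> k"
  shows "(\<Sum>Z\<in>Pow N. w Z * poly f (real (card Z))) = binomial_mean (card N) d (\<lambda>s. poly f (real s))"
proof -
  obtain a where a: "\<And>s. poly f (real s) = (\<Sum>j\<le>k. a j * real (s choose j))"
    using poly_newton_expansion[OF f] by blast
  have "(\<Sum>Z\<in>Pow N. w Z * poly f (real (card Z)))
      = (\<Sum>j\<le>k. a j * (\<Sum>Z\<in>Pow N. w Z * real (card Z choose j)))"
    unfolding a sum_distrib_left by (subst sum.swap) (simp add: mult_ac)
  also have "\<dots> = (\<Sum>j\<le>k. a j * (real (card N choose j) * d ^ j))"
    using moment by (simp add: sum_card_choose_eq[OF N])
  also have "\<dots> = (\<Sum>j\<le>k. a j * binomial_mean (card N) d (\<lambda>s. real (s choose j)))"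
    using binomial_mean_choose_choose[where i = 0] by simp
  finally show ?thesis by (simp only: a binomial_mean_sum binomial_mean_mult_left)
qed

text \<open>If \<open>card N * d < m\<close>, then \<open>(poly R s)\<^sup>2 * (1 - s)\<close> has
  degree at most \<open>2 * (m - 1) + 1\<close>, so its mean under \<open>w\<close> equals its
  binomial mean, which is positive. But it is nonpositive at every integer \<open>s \<ge> 1\<close>,
  and \<open>w\<close> gives no mass to the empty set.\<close>

lemma card_mult_ge_if_moments_odd:
  fixes w :: "'a set \<Rightarrow> real"
  assumes N: "finite N" and d: "0 < d" "d < 1"
    and w: "\<And>Z. 0 \<le> w Z" "w {} = 0"
    and moment: "\<And>J. J \<subseteq> N \<Longrightarrow> card J < 2 * m \<Longrightarrow> (\<Sum>Z | J \<subseteq> Z \<and> Z \<subseteq> N. w Z) = d ^ card J"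
  shows "real m \<le> real (card N) * d"
proof (rule ccontr)
  assume "\<not> real m \<le> real (card N) * d"
  then obtain R :: "real poly" where R: "degree R < m"
      "0 < binomial_mean (card N) d (\<lambda>s. (poly R (real s))\<^sup>2 * (1 - real s))"
    using binomial_mean_square_times_one_minus_pos d by (metis not_le)
  define f where "f = R\<^sup>2 * [:1, - 1:]"
  have f: "poly f x = (poly R x)\<^sup>2 * (1 - x)" for x by (simp add: f_def algebra_simps)
  have "degree f \<le> degree R + degree R + 1"
    unfolding f_def power2_eq_square
    using degree_mult_le[of "R * R" "[:1, - 1:]"] degree_mult_le[of R R] by simp
  then have "degree f \<le> 2 * m - 1" using R(1) by linarith
  moreover have "card J < 2 * m" if "card J \<le> 2 * m - 1" for J :: "'a set" using that R(1) by linarith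
  ultimately have "(\<Sum>Z\<in>Pow N. w Z * poly f (real (card Z))) > 0"
    using R(2) sum_poly_card_eq_binomial_mean[OF N, of "2 * m - 1" w d f] moment
    by (simp add: f)
  moreover have "w Z * poly f (real (card Z)) \<le> 0" if "Z \<subseteq> N" for Z
  proof (cases "Z = {}")
    case False
    then have "1 \<le> card Z" using that N by (simp add: Suc_le_eq card_gt_0_iff finite_subset)
    then show ?thesis using w by (auto simp: f intro!: mult_nonneg_nonpos)
  qed (simp add: w)
  then have "(\<Sum>Z\<in>Pow N. w Z * poly f (real (card Z))) \<le> 0" by (intro sum_nonpos) auto
  ultimately show False by simp
qed

text \<open>Conditioning on \<open>i \<notin> Z\<close> divides the weights by \<open>1 - d\<close>
  and costs one element and one order of moments, which leaves the odd case with the same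
  \<open>m\<close>.\<close>

lemma card_mult_ge_if_moments_even:
  fixes w :: "'a set \<Rightarrow> real"
  assumes N: "finite N" and d: "0 < d" "d < 1"
    and w: "\<And>Z. 0 \<le> w Z" "w {} = 0"
    and moment: "\<And>J. J \<subseteq> N \<Longrightarrow> card J \<le> 2 * m \<Longrightarrow> (\<Sum>Z | J \<subseteq> Z \<and> Z \<subseteq> N. w Z) = d ^ card J"
  shows "real m \<le> (real (card N) - 1) * d"
proof -
  \<comment> \<open>For empty \<open>N\<close>, the moment of \<open>J = {}\<close> would force
    \<open>w {} = 1\<close>.\<close>
  have "N \<noteq> {}"
  proof
    assume "N = {}"
    then have "{Z. Z \<subseteq> N} = {{}}" by auto
    then show False using moment[of "{}"] w by simp
  qed
  then obtain i where i: "i \<in> N" by blast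
  have moment': "(\<Sum>Z | J \<subseteq> Z \<and> Z \<subseteq> N - {i}. w Z / (1 - d)) = d ^ card J"
    if J: "J \<subseteq> N - {i}" "card J < 2 * m" for J
  proof -
    have fin: "finite J" using J N finite_subset by blast
    then have card: "card (insert i J) = Suc (card J)" using J(1) by (subst card_insert_disjoint) auto
    \<comment> \<open>Split on whether \<open>i \<in> Z\<close>. The part with
      \<open>i \<in> Z\<close> is the moment of \<open>insert i J\<close>, whose order is still at
      most \<open>2 * m\<close>.\<close>
    have "{Z. J \<subseteq> Z \<and> Z \<subseteq> N} = {Z. J \<subseteq> Z \<and> Z \<subseteq> N - {i}} \<union> {Z. insert i J \<subseteq> Z \<and> Z \<subseteq> N}"
      by auto
    then have "(\<Sum>Z | J \<subseteq> Z \<and> Z \<subseteq> N. w Z)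
        = (\<Sum>Z | J \<subseteq> Z \<and> Z \<subseteq> N - {i}. w Z) + (\<Sum>Z | insert i J \<subseteq> Z \<and> Z \<subseteq> N. w Z)"
      using N by (simp only:) (intro sum.union_disjoint, auto)
    moreover have "(\<Sum>Z | J \<subseteq> Z \<and> Z \<subseteq> N. w Z) = d ^ card J"
      using moment[of J] J by auto
    moreover have "(\<Sum>Z | insert i J \<subseteq> Z \<and> Z \<subseteq> N. w Z) = d ^ Suc (card J)"
      using moment[of "insert i J"] J i unfolding card by auto
    ultimately have "(\<Sum>Z | J \<subseteq> Z \<and> Z \<subseteq> N - {i}. w Z) = d ^ card J - d ^ Suc (card J)"
      by linarith
    also have "\<dots> = d ^ card J * (1 - d)" by (simp add: right_diff_distrib)
    finally show ?thesis using d by (simp add: sum_divide_distrib [symmetric])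
  qed
  have "real m \<le> real (card (N - {i})) * d"
  proof (rule card_mult_ge_if_moments_odd[OF _ d])
    show "(\<Sum>Z | J \<subseteq> Z \<and> Z \<subseteq> N - {i}. w Z / (1 - d)) = d ^ card J"
      if "J \<subseteq> N - {i}" "card J < 2 * m" for J
      using that by (rule moment')
  qed (use N d w in auto)
  moreover have "card N = Suc (card (N - {i}))" using N i by (rule card.remove)
  ultimately show ?thesis by simp
qed

section \<open>Moments of the zero bits\<close>

lemma kwise_dists_prob_zeros:
  assumes Q: "Q \<in> kwise_dists n k p" and J: "J \<subseteq> {..<n}" "card J \<le> k"
  shows "measure_pmf.prob Q {\<omega>. \<forall>i\<in>J. \<not> \<omega> i} = (1 - p) ^ card J"
proof (cases "J = {}")
  case False
  have fin: "finite J" using J finite_subset by blast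
  have one: "measure_pmf.prob Q ((\<lambda>\<omega>. \<omega> i) -` {False}) = 1 - p" if "i \<in> J" for i
  proof -
    have "measure_pmf.prob Q {\<omega>. \<omega> i} = p" using that Q J by (auto simp: kwise_dists_def)
    then show ?thesis
      using measure_pmf.prob_compl[of "{\<omega>. \<omega> i}" Q] by (simp add: vimage_def set_diff_eq)
  qed
  have "prob_space.indep_vars Q (\<lambda>_. count_space UNIV) (\<lambda>i \<omega>. \<omega> i) J"
    using Q J by (simp add: kwise_dists_def)
  from prob_space.indep_varsD[OF prob_space_measure_pmf this, of J "\<lambda>_. {False}"]
  have "measure_pmf.prob Q (\<Inter>i\<in>J. (\<lambda>\<omega>. \<omega> i) -` {False}) = (\<Prod>i\<in>J. measure_pmf.prob Q ((\<lambda>\<omega>. \<omega> i) -` {False}))"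
    using False fin by simp
  moreover have "(\<Inter>i\<in>J. (\<lambda>\<omega>. \<omega> i) -` {False}) = {\<omega>. \<forall>i\<in>J. \<not> \<omega> i}" by auto
  ultimately show ?thesis using one by simp
qed simp

text \<open>Checking the zero events is enough: the single event that bit \<open>i\<close> is zero
  forms an intersection-stable generator of the sigma-algebra of that bit. With \<open>k\<close>
  positive, the case \<open>J = {i}\<close> fixes the marginals.\<close>

lemma kwise_distsI:
  assumes supp: "set_pmf Q \<subseteq> {..<n} \<rightarrow>\<^sub>E UNIV" and k: "0 < k"
    and zeros: "\<And>J. J \<subseteq> {..<n} \<Longrightarrow> card J \<le> k \<Longrightarrow>
      measure_pmf.prob Q {\<omega>. \<forall>i\<in>J. \<not> \<omega> i} = (1 - p) ^ card J"
  shows "Q \<in> kwise_dists n k p"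
proof -
  have one: "measure_pmf.prob Q {\<omega>. \<not> \<omega> i} = 1 - p" if "i < n" for i
    using zeros[of "{i}"] that k by simp
  have "measure_pmf.prob Q {\<omega>. \<omega> i} = p" if "i < n" for i
    using one[OF that] measure_pmf.prob_compl[of "{\<omega>. \<omega> i}" Q] by (simp add: set_diff_eq)
  moreover have "prob_space.indep_vars Q (\<lambda>_. count_space UNIV) (\<lambda>i \<omega>. \<omega> i) S"
    if S: "S \<subseteq> {..<n}" "card S \<le> k" for S
  proof -
    have finS: "finite S" using S finite_subset by blast
    define E :: "nat \<Rightarrow> (nat \<Rightarrow> bool) set" where "E i = {\<omega>. \<not> \<omega> i}" for i
    have "prob_space.indep_sets Q (\<lambda>i. {E i}) S"
    proof (rule prob_space.indep_setsI[OF prob_space_measure_pmf])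
      fix A J assume J: "J \<noteq> {}" "J \<subseteq> S" "finite J" and A: "\<forall>j\<in>J. A j \<in> {E j}"
      then have AE: "A j = E j" if "j \<in> J" for j using that by simp
      then have "(\<Inter>j\<in>J. A j) = {\<omega>. \<forall>i\<in>J. \<not> \<omega> i}" by (simp add: E_def set_eq_iff)
      then have "measure_pmf.prob Q (\<Inter>j\<in>J. A j) = measure_pmf.prob Q {\<omega>. \<forall>i\<in>J. \<not> \<omega> i}"
        by simp
      also have "\<dots> = (1 - p) ^ card J"
        using J S card_mono[OF finS, of J] by (intro zeros) auto
      also have "\<dots> = (\<Prod>j\<in>J. measure_pmf.prob Q (A j))"
      proof -
        have "measure_pmf.prob Q (A j) = 1 - p" if "j \<in> J" for j
          using AE[OF that] J(2) S(1) one[of j] that by (auto simp: E_def)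
        then show ?thesis by simp
      qed
      finally show "measure_pmf.prob Q (\<Inter>j\<in>J. A j) = (\<Prod>j\<in>J. measure_pmf.prob Q (A j))" .
    qed simp
    then have "prob_space.indep_sets Q (\<lambda>i. sigma_sets (space Q) {E i}) S"
      by (rule prob_space.indep_sets_sigma[OF prob_space_measure_pmf]) (simp add: Int_stable_def)
    then have "prob_space.indep_sets Q (\<lambda>i. {(\<lambda>\<omega>. \<omega> i) -` A \<inter> space Q |A. A \<in> sets (count_space UNIV)}) S"
    proof (rule prob_space.indep_sets_mono_sets[OF prob_space_measure_pmf])
      fix i
      have "(\<lambda>\<omega>. \<omega> i) -` A \<in> sigma_sets UNIV {E i}" for A
      proof -
        have "A = {} \<or> A = UNIV \<or> A = {False} \<or> A = {True}"
          unfolding set_eq_iff all_bool_eq by simp blast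
        moreover have "(\<lambda>\<omega>. \<omega> i) -` {False} = E i" by (auto simp: E_def)
        moreover have "(\<lambda>\<omega>. \<omega> i) -` {True} = UNIV - E i" by (auto simp: E_def)
        moreover have "E i \<in> sigma_sets UNIV {E i}" by (simp add: sigma_sets.Basic)
        ultimately show ?thesis
          using sigma_sets.Empty[of UNIV "{E i}"] sigma_sets_top[of UNIV "{E i}"]
            sigma_sets.Compl[of "E i" UNIV "{E i}"]
          by (elim disjE) simp_all
      qed
      then show "{(\<lambda>\<omega>. \<omega> i) -` A \<inter> space Q |A. A \<in> sets (count_space UNIV)} \<subseteq> sigma_sets (space Q) {E i}"
        by auto
    qed
    then show ?thesis by (simp add: prob_space.indep_vars_def2[OF prob_space_measure_pmf])
  qed
  ultimately show ?thesis using supp by (simp add: kwise_dists_def)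
qed

section \<open>Distributions of small support\<close>

text \<open>A homogeneous system with more unknowns than equations, solved by eliminating one
  equation at a time.\<close>

lemma exists_linear_relation:
  fixes g :: "'b \<Rightarrow> 'a \<Rightarrow> real"
  assumes "finite E" "finite T" "card E < card T"
  obtains c where "\<And>e. e \<in> E \<Longrightarrow> (\<Sum>x\<in>T. c x * g e x) = 0" "\<exists>x\<in>T. c x \<noteq> 0"
proof -
  have "\<exists>c. (\<forall>e\<in>E. (\<Sum>x\<in>T. c x * g e x) = 0) \<and> (\<exists>x\<in>T. c x \<noteq> 0)"
    using assms
  proof (induction E arbitrary: T g rule: finite_induct)
    case empty
    then have "T \<noteq> {}" by auto
    then show ?case by (intro exI[of _ "\<lambda>_. 1"]) auto
  next
    case (insert e E)
    show ?case
    proof (cases "\<exists>t\<in>T. g e t \<noteq> 0")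
      case False
      from insert obtain c where "\<forall>e\<in>E. (\<Sum>x\<in>T. c x * g e x) = 0" "\<exists>x\<in>T. c x \<noteq> 0"
        by (metis Suc_lessD card_insert_disjoint)
      then show ?thesis using False by (intro exI[of _ c]) auto
    next
      case True
      then obtain t where t: "t \<in> T" "g e t \<noteq> 0" by blast
      \<comment> \<open>Pivot \<open>g e t\<close>: subtracting a multiple of row \<open>e\<close>
        makes every \<open>h e'\<close> vanish at \<open>t\<close>. A relation found on
        \<open>T - {t}\<close> is then extended by the value at \<open>t\<close> that solves row
        \<open>e\<close>.\<close>
      define h where "h e' x = g e' x - g e' t / g e t * g e x" for e' x
      have "card E < card (T - {t})" using insert t by simp
      then obtain c where c: "\<forall>e\<in>E. (\<Sum>x\<in>T - {t}. c x * h e x) = 0" "\<exists>x\<in>T - {t}. c x \<noteq> 0"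
        using insert.IH[of "T - {t}" h] insert.prems by auto
      define s where "s = (\<Sum>x\<in>T - {t}. c x * g e x)"
      define c' where "c' = c(t := - s / g e t)"
      have split: "(\<Sum>x\<in>T. c' x * g e' x) = - s / g e t * g e' t + (\<Sum>x\<in>T - {t}. c x * g e' x)" for e'
        using t insert.prems by (subst sum.remove[of T t]) (auto simp: c'_def intro!: sum.cong)
      have "(\<Sum>x\<in>T. c' x * g e' x) = 0" if "e' \<in> insert e E" for e'
      proof (cases "e' = e")
        case True
        then show ?thesis using t by (simp add: split s_def)
      next
        case False
        then have "0 = (\<Sum>x\<in>T - {t}. c x * h e' x)" using that c by simp
        also have "\<dots> = (\<Sum>x\<in>T - {t}. c x * g e' x) - g e' t / g e t * s"
          by (simp add: h_def s_def sum_distrib_left sum_subtractf [symmetric] algebra_simps)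
        finally show ?thesis by (simp add: split)
      qed
      moreover have "\<exists>x\<in>T. c' x \<noteq> 0" using c by (auto simp: c'_def)
      ultimately show ?thesis by blast
    qed
  qed
  then show ?thesis using that by blast
qed

text \<open>Take feasible weights of least support. If that support had more than
  \<open>card E\<close> points, a linear relation on it could be subtracted until some weight
  reaches zero, with no change to the sums indexed by \<open>E\<close>.\<close>

lemma exists_nonneg_weights_small_support:
  fixes g :: "'b \<Rightarrow> 'a \<Rightarrow> real"
  assumes E: "finite E" and X: "finite X" and w0: "\<And>x. x \<in> X \<Longrightarrow> 0 \<le> w0 x"
  obtains w where "\<And>x. x \<in> X \<Longrightarrow> 0 \<le> w x"
    "\<And>e. e \<in> E \<Longrightarrow> (\<Sum>x\<in>X. w x * g e x) = (\<Sum>x\<in>X. w0 x * g e x)"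
    "card {x \<in> X. w x \<noteq> 0} \<le> card E"
proof -
  define P where "P w \<longleftrightarrow> (\<forall>x\<in>X. 0 \<le> w x) \<and> (\<forall>e\<in>E. (\<Sum>x\<in>X. w x * g e x) = (\<Sum>x\<in>X. w0 x * g e x))" for w
  have "P w0" by (simp add: P_def w0)
  then obtain w where w: "P w"
    and least: "\<And>v. P v \<Longrightarrow> card {x \<in> X. w x \<noteq> 0} \<le> card {x \<in> X. v x \<noteq> 0}"
    using ex_has_least_nat[of P w0 "\<lambda>w. card {x \<in> X. w x \<noteq> 0}"] by blast
  have "card {x \<in> X. w x \<noteq> 0} \<le> card E"
  proof (rule ccontr)
    define T where "T = {x \<in> X. w x \<noteq> 0}"
    assume "\<not> card {x \<in> X. w x \<noteq> 0} \<le> card E"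
    then have "card E < card T" by (simp add: T_def)
    moreover have finT: "finite T" using X by (simp add: T_def)
    ultimately obtain c0 where c0: "\<And>e. e \<in> E \<Longrightarrow> (\<Sum>x\<in>T. c0 x * g e x) = 0" "\<exists>x\<in>T. c0 x \<noteq> 0"
      using exists_linear_relation[OF E] by metis
    \<comment> \<open>Negating \<open>c0\<close> if necessary gives a positive entry, so the step
      length below is bounded.\<close>
    obtain c where c: "\<And>e. e \<in> E \<Longrightarrow> (\<Sum>x\<in>T. c x * g e x) = 0" "\<exists>x\<in>T. 0 < c x"
    proof (cases "\<exists>x\<in>T. 0 < c0 x")
      case False
      then show ?thesis using c0 that[of "\<lambda>x. - c0 x"] by (force simp: sum_negf)
    qed (use c0 that in blast)
    define T' where "T' = {x \<in> T. 0 < c x}"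
    have T': "finite T'" "T' \<noteq> {}" using c finT by (auto simp: T'_def)
    \<comment> \<open>The largest \<open>t\<close> that keeps \<open>w - t * c\<close> nonnegative
      on \<open>T\<close>: only entries with \<open>c x > 0\<close> restrict it, and at a minimiser
      \<open>x0\<close> the new weight is zero.\<close>
    define t where "t = Min ((\<lambda>x. w x / c x) ` T')"
    have wpos: "0 < w x" if "x \<in> T" for x
      using that w by (auto simp: T_def P_def order.not_eq_order_implies_strict)
    have "t \<in> (\<lambda>x. w x / c x) ` T'" unfolding t_def using T' by (intro Min_in) auto
    then obtain x0 where x0: "x0 \<in> T'" "t = w x0 / c x0" by blast
    have t_le: "t * c x \<le> w x" if "x \<in> T" for x
    proof (cases "0 < c x")
      case True
      then have "t \<le> w x / c x" unfolding t_def using T' that by (intro Min_le) (auto simp: T'_def)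
      then show ?thesis using True by (simp add: field_simps)
    next
      case False
      moreover have "0 \<le> t" using x0 wpos[of x0] by (auto simp: T'_def)
      ultimately have "t * c x \<le> 0" by (simp add: mult_nonneg_nonpos)
      then show ?thesis using wpos[OF that] by simp
    qed
    define v where "v x = (if x \<in> T then w x - t * c x else w x)" for x
    have "P v"
    proof -
      have "(\<Sum>x\<in>X. v x * g e x) = (\<Sum>x\<in>X. w x * g e x)" if "e \<in> E" for e
      proof -
        have "(\<Sum>x\<in>X. v x * g e x) = (\<Sum>x\<in>X. w x * g e x - t * (if x \<in> T then c x * g e x else 0))"
          by (intro sum.cong) (auto simp: v_def algebra_simps)
        also have "\<dots> = (\<Sum>x\<in>X. w x * g e x) - t * (\<Sum>x\<in>X. if x \<in> T then c x * g e x else 0)"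
          by (simp only: sum_subtractf sum_distrib_left)
        also have "(\<Sum>x\<in>X. if x \<in> T then c x * g e x else 0) = (\<Sum>x\<in>X \<inter> T. c x * g e x)"
          by (rule sum.inter_restrict[OF X, symmetric])
        also have "X \<inter> T = T" by (auto simp: T_def)
        finally show ?thesis using c that by simp
      qed
      moreover have "\<forall>x\<in>X. 0 \<le> v x" using w t_le by (auto simp: v_def P_def)
      ultimately show ?thesis using w by (simp add: P_def)
    qed
    then have "card T \<le> card {x \<in> X. v x \<noteq> 0}" using least by (simp add: T_def)
    moreover have "{x \<in> X. v x \<noteq> 0} \<subseteq> T - {x0}"
      using x0 by (auto simp: v_def T_def T'_def)
    then have "card {x \<in> X. v x \<noteq> 0} \<le> card (T - {x0})" using finT by (intro card_mono) auto
    moreover have "card (T - {x0}) < card T" using x0 finT by (intro card_Diff1_less) (auto simp: T'_def)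
    ultimately show False by simp
  qed
  with w show ?thesis using that by (auto simp: P_def)
qed

section \<open>Construction of a distribution that avoids the all-ones outcome\<close>

lemma exists_kwise_dist_no_all_ones:
  assumes q: "0 < q" and k: "0 < k"
    and small: "(\<Sum>J | J \<subseteq> {..<n} \<and> card J \<le> k. q ^ card J) * (q - 1) ^ n < q ^ n"
  obtains Q where "Q \<in> kwise_dists n k (1 - 1 / real q)"
    "measure_pmf.prob Q {\<omega>. \<forall>i<n. \<omega> i} = 0"
proof -
  define X where "X = ({..<n} \<rightarrow>\<^sub>E {..<q})"
  \<comment> \<open>One linear constraint for each set \<open>J\<close> of at most \<open>k\<close>
    positions and each pattern of letters on \<open>J\<close>; \<open>g\<close> tests whether a word
    matches the pattern. The number of constraints will bound the support.\<close>
  define E where "E = (SIGMA J:{J. J \<subseteq> {..<n} \<and> card J \<le> k}. J \<rightarrow>\<^sub>E {..<q})"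
  define g :: "nat set \<times> (nat \<Rightarrow> nat) \<Rightarrow> (nat \<Rightarrow> nat) \<Rightarrow> real"
    where "g e y = (if \<forall>i\<in>fst e. y i = snd e i then 1 else 0)" for e y
  have finJ: "finite {J. J \<subseteq> {..<n} \<and> card J \<le> k}" by simp
  have finsub: "finite J" if "J \<subseteq> {..<n}" for J using that finite_subset by blast
  have finE: "finite E" unfolding E_def using finJ finsub by (intro finite_SigmaI finite_PiE) auto
  have finX: "finite X" unfolding X_def by (intro finite_PiE) auto
  have cardX: "card X = q ^ n" by (simp add: X_def card_PiE)
  have cardE: "card E = (\<Sum>J | J \<subseteq> {..<n} \<and> card J \<le> k. q ^ card J)"
    unfolding E_def using finJ finsub by (subst card_SigmaI) (auto simp: card_PiE finite_PiE)
  obtain w where w: "\<And>x. x \<in> X \<Longrightarrow> 0 \<le> w x"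
    "\<And>e. e \<in> E \<Longrightarrow> (\<Sum>x\<in>X. w x * g e x) = (\<Sum>x\<in>X. 1 / real q ^ n * g e x)"
    "card {x \<in> X. w x \<noteq> 0} \<le> card E"
    by (rule exists_nonneg_weights_small_support[OF finE finX, of "\<lambda>_. 1 / real q ^ n" g]) auto
  \<comment> \<open>The constraints carry the marginals of the uniform distribution over to
    \<open>w\<close>. The case \<open>J = {}\<close> later gives total mass one.\<close>
  have agree: "(\<Sum>y\<in>X. if \<forall>i\<in>J. y i = a i then w y else 0) = 1 / real q ^ card J"
    if J: "J \<subseteq> {..<n}" "card J \<le> k" and a: "a \<in> X" for J a
  proof -
    have e: "(J, restrict a J) \<in> E" using J a by (auto simp: E_def X_def)
    have "(\<Sum>y\<in>X. if \<forall>i\<in>J. y i = a i then w y else 0) = (\<Sum>y\<in>X. w y * g (J, restrict a J) y)"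
      by (intro sum.cong) (auto simp: g_def)
    also have "\<dots> = (\<Sum>y\<in>X. 1 / real q ^ n * g (J, restrict a J) y)" using w(2)[OF e] .
    also have "\<dots> = (\<Sum>y\<in>X. if \<forall>i\<in>J. y i = a i then 1 / real q ^ n else 0)"
      by (intro sum.cong) (auto simp: g_def)
    also have "\<dots> = real (card {y\<in>X. \<forall>i\<in>J. y i = a i}) / real q ^ n"
      using finX by (simp add: sum.inter_filter [symmetric])
    also have "{y\<in>X. \<forall>i\<in>J. y i = a i} = (\<Pi>\<^sub>E i\<in>{..<n}. if i \<in> J then {a i} else {..<q})"
    proof (intro set_eqI iffI)
      fix y assume y: "y \<in> (\<Pi>\<^sub>E i\<in>{..<n}. if i \<in> J then {a i} else {..<q})"
      have yi: "y i \<in> (if i \<in> J then {a i} else {..<q})" if "i < n" for i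
        using y that by (auto simp: PiE_iff)
      have ai: "a i < q" if "i < n" for i using a that by (auto simp: X_def PiE_iff)
      have "y i = a i" if "i \<in> J" for i using yi[of i] J(1) that by auto
      moreover have "y i < q" if "i < n" for i
        using yi[OF that] ai[OF that] by (auto split: if_splits)
      moreover have "y \<in> extensional {..<n}" using y by (simp add: PiE_iff)
      ultimately show "y \<in> {y\<in>X. \<forall>i\<in>J. y i = a i}" by (simp add: X_def PiE_iff)
    qed (auto simp: X_def PiE_iff)
    also have "card \<dots> = (\<Prod>i<n. if i \<in> J then 1 else q)"
      by (subst card_PiE) (auto intro!: prod.cong)
    also have "\<dots> = q ^ (n - card J)"
    proof -
      have "{..<n} \<inter> - J = {..<n} - J" by auto
      then show ?thesis using J finsub by (simp add: prod.If_cases card_Diff_subset)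
    qed
    also have "real (q ^ (n - card J)) / real q ^ n = 1 / real q ^ card J"
    proof -
      have "card J \<le> n" using card_mono[of "{..<n}" J] J by simp
      then have "real q ^ n = real q ^ (n - card J) * real q ^ card J"
        by (simp add: power_add [symmetric])
      then show ?thesis using q by simp
    qed
    finally show ?thesis .
  qed
  define T where "T = {x \<in> X. w x \<noteq> 0}"
  \<comment> \<open>Each \<open>y\<close> rules out the \<open>(q - 1) ^ n\<close> words that differ
    from it everywhere; by \<open>small\<close> these cannot exhaust \<open>X\<close>.\<close>
  have "\<exists>a\<in>X. \<forall>y\<in>T. \<exists>i<n. y i = a i"
  proof (rule ccontr)
    assume neg: "\<not> (\<exists>a\<in>X. \<forall>y\<in>T. \<exists>i<n. y i = a i)"
    have sub: "X \<subseteq> (\<Union>y\<in>T. \<Pi>\<^sub>E i\<in>{..<n}. {..<q} - {y i})"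
    proof
      fix a assume a: "a \<in> X"
      then obtain y where "y \<in> T" "\<And>i. i < n \<Longrightarrow> a i \<noteq> y i" using neg by metis
      with a have "a \<in> (\<Pi>\<^sub>E i\<in>{..<n}. {..<q} - {y i})" by (auto simp: X_def PiE_iff)
      with \<open>y \<in> T\<close> show "a \<in> (\<Union>y\<in>T. \<Pi>\<^sub>E i\<in>{..<n}. {..<q} - {y i})" by blast
    qed
    have finT: "finite T" using finX by (simp add: T_def)
    have "card X \<le> card (\<Union>y\<in>T. \<Pi>\<^sub>E i\<in>{..<n}. {..<q} - {y i})"
      using sub finT by (intro card_mono finite_UN_I finite_PiE) auto
    also have "\<dots> \<le> (\<Sum>y\<in>T. card (\<Pi>\<^sub>E i\<in>{..<n}. {..<q} - {y i}))"
      using finT by (rule card_UN_le)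
    also have "\<dots> = (\<Sum>y\<in>T. (q - 1) ^ n)"
    proof (rule sum.cong)
      fix y assume "y \<in> T"
      then have "card ({..<q} - {y i}) = q - 1" if "i < n" for i
        using that by (auto simp: T_def X_def PiE_iff)
      then show "card (\<Pi>\<^sub>E i\<in>{..<n}. {..<q} - {y i}) = (q - 1) ^ n" by (simp add: card_PiE)
    qed simp
    also have "\<dots> \<le> card E * (q - 1) ^ n" using w(3) by (simp add: T_def)
    also have "\<dots> < q ^ n" using small by (simp add: cardE)
    finally show False by (simp add: cardX)
  qed
  then obtain a where a: "a \<in> X" "\<And>y. y \<in> T \<Longrightarrow> \<exists>i<n. y i = a i" by blast
  define P where "P = embed_pmf (\<lambda>y. if y \<in> X then w y else 0)"
  have P: "pmf P y = (if y \<in> X then w y else 0)" for y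
    unfolding P_def
  proof (rule pmf_embed_pmf)
    have "(\<integral>\<^sup>+ y. ennreal (if y \<in> X then w y else 0) \<partial>count_space UNIV) = (\<Sum>y\<in>X. ennreal (if y \<in> X then w y else 0))"
      using finX by (intro nn_integral_count_space') auto
    also have "\<dots> = ennreal (\<Sum>y\<in>X. w y)" using w(1) by (subst sum_ennreal [symmetric]) auto
    also have "(\<Sum>y\<in>X. w y) = 1" using agree[of "{}" a] a by simp
    finally show "(\<integral>\<^sup>+ y. ennreal (if y \<in> X then w y else 0) \<partial>count_space UNIV) = 1" by simp
  qed (use w(1) in auto)
  have supp: "set_pmf P = T" by (auto simp: set_pmf_eq P T_def)
  have probP: "measure_pmf.prob P A = (\<Sum>y\<in>X. if y \<in> A then w y else 0)" for A
  proof -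
    have "measure_pmf.prob P A = measure_pmf.prob P (X \<inter> A)"
      by (intro measure_prob_cong_0) (auto simp: P)
    also have "\<dots> = (\<Sum>y\<in>X \<inter> A. pmf P y)" using finX by (simp add: measure_measure_pmf_finite)
    also have "\<dots> = (\<Sum>y\<in>X \<inter> A. w y)" by (intro sum.cong) (auto simp: P)
    finally show ?thesis using finX by (simp add: sum.inter_restrict)
  qed
  \<comment> \<open>Comparison with \<open>a\<close> makes each bit zero with probability
    \<open>1 / q\<close>. All bits being one would mean a word of the support that differs from
    \<open>a\<close> everywhere.\<close>
  define Q where "Q = map_pmf (\<lambda>y. \<lambda>i\<in>{..<n}. y i \<noteq> a i) P"
  have "Q \<in> kwise_dists n k (1 - 1 / real q)"
  proof (rule kwise_distsI[OF _ k])
    show "set_pmf Q \<subseteq> {..<n} \<rightarrow>\<^sub>E UNIV" by (auto simp: Q_def)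
    fix J assume J: "J \<subseteq> {..<n}" "card J \<le> k"
    have "(\<lambda>y. \<lambda>i\<in>{..<n}. y i \<noteq> a i) -` {\<omega>. \<forall>i\<in>J. \<not> \<omega> i} = {y. \<forall>i\<in>J. y i = a i}"
      using J(1) by auto
    then have "measure_pmf.prob Q {\<omega>. \<forall>i\<in>J. \<not> \<omega> i} = measure_pmf.prob P {y. \<forall>i\<in>J. y i = a i}"
      by (simp add: Q_def)
    also have "\<dots> = 1 / real q ^ card J" using agree[OF J a(1)] by (simp add: probP)
    finally show "measure_pmf.prob Q {\<omega>. \<forall>i\<in>J. \<not> \<omega> i} = (1 - (1 - 1 / real q)) ^ card J"
      by (simp add: power_one_over)
  qed
  moreover have "measure_pmf.prob Q {\<omega>. \<forall>i<n. \<omega> i} = 0"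
  proof -
    have "\<omega> \<notin> {\<omega>. \<forall>i<n. \<omega> i}" if "\<omega> \<in> set_pmf Q" for \<omega>
    proof -
      from that obtain y where y: "y \<in> T" "\<omega> = (\<lambda>i\<in>{..<n}. y i \<noteq> a i)"
        by (auto simp: Q_def supp)
      from a(2)[OF y(1)] obtain i where "i < n" "y i = a i" by blast
      then show ?thesis by (auto simp: y(2))
    qed
    then have "set_pmf Q \<inter> {\<omega>. \<forall>i<n. \<omega> i} = {}" by blast
    then show ?thesis by (simp add: measure_pmf_zero_iff)
  qed
  ultimately show ?thesis using that by blast
qed

section \<open>Estimates for the union bound\<close>

lemma sum_power_card_le:
  fixes x r :: real
  assumes N: "finite N" and r: "0 < r" "r \<le> 1" and x: "0 \<le> x"
  shows "(\<Sum>J | J \<subseteq> N \<and> card J \<le> k. x ^ card J) \<le> (1 / r) ^ k * exp (real (card N) * (r * x))"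
proof -
  have "(\<Sum>J | J \<subseteq> N \<and> card J \<le> k. x ^ card J)
      \<le> (\<Sum>J | J \<subseteq> N \<and> card J \<le> k. (1 / r) ^ k * (r * x) ^ card J)"
  proof (rule sum_mono)
    fix J assume "J \<in> {J. J \<subseteq> N \<and> card J \<le> k}"
    then have "(1 / r) ^ card J \<le> (1 / r) ^ k" using r by (intro power_increasing) auto
    then have "(1 / r) ^ card J * (r * x) ^ card J \<le> (1 / r) ^ k * (r * x) ^ card J"
      using r x by (intro mult_right_mono) auto
    moreover have "(1 / r) ^ card J * (r * x) ^ card J = x ^ card J"
      using r by (simp add: power_mult_distrib [symmetric])
    ultimately show "x ^ card J \<le> (1 / r) ^ k * (r * x) ^ card J" by simp
  qed
  also have "\<dots> \<le> (\<Sum>J\<in>Pow N. (1 / r) ^ k * (r * x) ^ card J)"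
    using N r x by (intro sum_mono2) auto
  also have "\<dots> = (1 / r) ^ k * (r * x + 1) ^ card N"
    using prod_add[OF N, of "\<lambda>_. r * x" "\<lambda>_. 1"] by (simp add: sum_distrib_left)
  also have "\<dots> \<le> (1 / r) ^ k * exp (r * x) ^ card N"
    using r x exp_ge_add_one_self[of "r * x"] by (intro mult_left_mono power_mono) (auto simp: add.commute)
  finally show ?thesis by (simp add: exp_of_nat_mult)
qed

text \<open>The sum is at most \<open>(30 * q ^ 3) ^ k\<close> by the upper bound on
  \<open>n\<close>, while \<open>(1 - 1 / q) ^ n \<le> 1 / (q ^ 9) ^ k\<close> by the lower bound.
  The product is below one because \<open>30 < 2 ^ 6 \<le> q ^ 6\<close>.\<close>

lemma sum_power_card_times_power_less:
  fixes q k n :: nat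
  assumes q: "2 \<le> q" and k: "0 < k"
    and n: "9 * (real k * real q * ln (real q)) \<le> real n" "real n \<le> 10 * (real k * real q * ln (real q))"
  shows "(\<Sum>J | J \<subseteq> {..<n} \<and> card J \<le> k. q ^ card J) * (q - 1) ^ n < q ^ n"
proof -
  define x where "x = real q"
  have x: "2 \<le> x" using q by (simp add: x_def)
  have ln_ge: "2 / 3 \<le> ln x"
    using order_trans[OF ln2_ge_two_thirds, of "ln x"] x by simp
  have ln_le: "ln x \<le> x" using x ln_le_minus_one[of x] by simp
  have "0 < 9 * (real k * x * ln x)" using k x ln_ge by simp
  then have npos: "0 < real n" using n(1) unfolding x_def by linarith
  \<comment> \<open>Makes the exponent \<open>n * (r * x)\<close> equal to \<open>k\<close>, so the
    exponential contributes only \<open>exp 1 ^ k \<le> 3 ^ k\<close>.\<close>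
  define r where "r = real k / (real n * x)"
  have r0: "0 < r" using k npos x by (simp add: r_def)
  have "real k * 1 \<le> real k * (9 * (x * ln x) * x)"
  proof (rule mult_left_mono)
    have "2 * (2 / 3) \<le> x * ln x" using x ln_ge by (intro mult_mono) auto
    then have "(9 * (4 / 3)) * 2 \<le> 9 * (x * ln x) * x" using x by (intro mult_mono) auto
    then show "1 \<le> 9 * (x * ln x) * x" by linarith
  qed simp
  also have "\<dots> = 9 * (real k * x * ln x) * x" by simp
  also have "\<dots> \<le> real n * x" using n(1) x by (intro mult_right_mono) (auto simp: x_def)
  finally have r1: "r \<le> 1" using npos x by (simp add: r_def)
  have inv_r: "1 / r \<le> 10 * x ^ 3"
  proof -
    have "1 / r = real n * x / real k" by (simp add: r_def)
    also have "\<dots> \<le> 10 * (real k * x * ln x) * x / real k"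
      using n(2) x by (intro divide_right_mono mult_right_mono) (auto simp: x_def)
    also have "\<dots> = 10 * x * x * ln x" using k by simp
    also have "\<dots> \<le> 10 * x * x * x" using x ln_le by (intro mult_left_mono) auto
    finally show ?thesis by (simp add: power3_eq_cube)
  qed
  have "(\<Sum>J | J \<subseteq> {..<n} \<and> card J \<le> k. x ^ card J) \<le> (1 / r) ^ k * exp (real n * (r * x))"
    using sum_power_card_le[of "{..<n}" r x k] r0 r1 x by simp
  also have "real n * (r * x) = real k * 1" using npos x by (simp add: r_def)
  also have "exp (real k * 1) = exp 1 ^ k" by (rule exp_of_nat_mult)
  also have "(1 / r) ^ k * exp 1 ^ k \<le> (10 * x ^ 3) ^ k * 3 ^ k"
    using r0 inv_r exp_le x by (intro mult_mono power_mono) auto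
  also have "\<dots> = (30 * x ^ 3) ^ k" by (subst power_mult_distrib [symmetric]) simp
  finally have S: "(\<Sum>J | J \<subseteq> {..<n} \<and> card J \<le> k. x ^ card J) \<le> (30 * x ^ 3) ^ k" .
  have "(1 - 1 / x) ^ n \<le> exp (- (1 / x)) ^ n"
    using x exp_ge_add_one_self[of "- (1 / x)"] by (intro power_mono) auto
  also have "\<dots> = exp (- (real n / x))" by (simp add: exp_of_nat_mult [symmetric])
  also have "\<dots> \<le> exp (- (real (9 * k) * ln x))"
    using n(1) x by (simp add: x_def field_simps)
  also have "\<dots> = 1 / (x ^ 9) ^ k"
  proof -
    have "exp (real (9 * k) * ln x) = exp (ln x) ^ (9 * k)" by (rule exp_of_nat_mult)
    then show ?thesis using x by (simp add: exp_minus power_mult inverse_eq_divide)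
  qed
  finally have T: "(1 - 1 / x) ^ n \<le> 1 / (x ^ 9) ^ k" .
  have "(30 * x ^ 3) ^ k < (x ^ 9) ^ k"
  proof (rule power_strict_mono)
    have "(2::real) ^ 6 \<le> x ^ 6" using x by (intro power_mono) auto
    then have "30 * x ^ 3 < x ^ 6 * x ^ 3" using x by (intro mult_strict_right_mono) auto
    then show "30 * x ^ 3 < x ^ 9" by (simp add: power_add [symmetric])
  qed (use x k in auto)
  then have "(30 * x ^ 3) ^ k * (1 / (x ^ 9) ^ k) < 1" using x by simp
  moreover have "(\<Sum>J | J \<subseteq> {..<n} \<and> card J \<le> k. x ^ card J) * (1 - 1 / x) ^ n
      \<le> (30 * x ^ 3) ^ k * (1 / (x ^ 9) ^ k)"
    using S T x by (intro mult_mono) auto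
  ultimately have "(\<Sum>J | J \<subseteq> {..<n} \<and> card J \<le> k. x ^ card J) * (1 - 1 / x) ^ n < 1" by linarith
  then have "(\<Sum>J | J \<subseteq> {..<n} \<and> card J \<le> k. x ^ card J) * (1 - 1 / x) ^ n * x ^ n < 1 * x ^ n"
    using x by (intro mult_strict_right_mono) auto
  moreover have "(1 - 1 / x) ^ n * x ^ n = (x - 1) ^ n"
    using x by (subst power_mult_distrib [symmetric]) (simp add: left_diff_distrib)
  ultimately have "(\<Sum>J | J \<subseteq> {..<n} \<and> card J \<le> k. x ^ card J) * (x - 1) ^ n < x ^ n"
    by (simp add: mult.assoc)
  moreover have "real (q - 1) = x - 1" using q by (simp add: x_def of_nat_diff)
  ultimately have "real ((\<Sum>J | J \<subseteq> {..<n} \<and> card J \<le> k. q ^ card J) * (q - 1) ^ n) < real (q ^ n)"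
    unfolding of_nat_mult of_nat_sum of_nat_power by (simp only: x_def)
  then show ?thesis by (simp only: of_nat_less_iff)
qed

section \<open>The bounds on the critical number of bits\<close>

lemma n_c_le:
  fixes q k :: nat
  assumes q: "2 \<le> q" and k: "0 < k"
  shows "ereal_of_enat (n_c k (1 - 1 / real q)) \<le> ereal (10 * (real k * real q * ln (real q)))"
proof -
  define y where "y = real k * real q * ln (real q)"
  \<comment> \<open>The ceiling stays below \<open>10 * y\<close> because
    \<open>y \<ge> 4 / 3\<close>.\<close>
  define n where "n = nat \<lceil>9 * y\<rceil>"
  have "2 / 3 \<le> ln (real q)"
    using order_trans[OF ln2_ge_two_thirds, of "ln (real q)"] q by simp
  then have "1 * 2 * (2 / 3) \<le> y" unfolding y_def using q k by (intro mult_mono) auto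
  then have n: "9 * y \<le> real n" "real n \<le> 10 * y"
    unfolding n_def by linarith+
  obtain Q where Q: "Q \<in> kwise_dists n k (1 - 1 / real q)"
    "measure_pmf.prob Q {\<omega>. \<forall>i<n. \<omega> i} = 0"
    using exists_kwise_dist_no_all_ones[of q k n] sum_power_card_times_power_less[OF q k] n q k
    unfolding y_def by auto
  have "min_all_ones n k (1 - 1 / real q) = 0"
    unfolding min_all_ones_def
  proof (rule cInf_eq_minimum)
    show "0 \<in> (\<lambda>Q. measure_pmf.prob Q {\<omega>. \<forall>i<n. \<omega> i}) ` kwise_dists n k (1 - 1 / real q)"
      using Q by force
  qed auto
  then have "n_c k (1 - 1 / real q) \<le> enat n" unfolding n_c_def by (intro Inf_lower) auto
  then have "ereal_of_enat (n_c k (1 - 1 / real q)) \<le> ereal_of_enat (enat n)"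
    by (simp only: ereal_of_enat_le_iff)
  also have "\<dots> \<le> ereal (10 * y)" using n by simp
  finally show ?thesis by (simp add: y_def)
qed

text \<open>The minimum is attained, so some \<open>Q\<close> never yields all ones. The law of its
  set of zero positions then gives the empty set no mass, and the moment inequalities apply with
  \<open>d = 1 - p\<close>.\<close>

lemma min_all_ones_eq_0_imp_ge:
  assumes p: "0 < p" "p < 1" and k: "0 < k" and zero: "min_all_ones n k p = 0"
  shows "(if even k then real k / (2 * (1 - p)) + 1 else (real k + 1) / (2 * (1 - p))) \<le> real n"
proof -
  obtain Q where Q: "Q \<in> kwise_dists n k p" "measure_pmf.prob Q {\<omega>. \<forall>i<n. \<omega> i} = 0"
    using min_all_ones_attained[of p n k] p zero by auto
  define W where "W = map_pmf (\<lambda>\<omega>. {i. i < n \<and> \<not> \<omega> i}) Q"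
  have moment: "(\<Sum>Z | J \<subseteq> Z \<and> Z \<subseteq> {..<n}. pmf W Z) = (1 - p) ^ card J"
    if J: "J \<subseteq> {..<n}" "card J \<le> k" for J
  proof -
    have "finite {Z. J \<subseteq> Z \<and> Z \<subseteq> {..<n}}" by (rule finite_subset[of _ "Pow {..<n}"]) auto
    then have "(\<Sum>Z | J \<subseteq> Z \<and> Z \<subseteq> {..<n}. pmf W Z) = measure_pmf.prob W {Z. J \<subseteq> Z \<and> Z \<subseteq> {..<n}}"
      by (simp add: measure_measure_pmf_finite)
    also have "\<dots> = measure_pmf.prob Q {\<omega>. \<forall>i\<in>J. \<not> \<omega> i}"
    proof -
      have "(\<lambda>\<omega>. {i. i < n \<and> \<not> \<omega> i}) -` {Z. J \<subseteq> Z \<and> Z \<subseteq> {..<n}} = {\<omega>. \<forall>i\<in>J. \<not> \<omega> i}"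
        using J(1) by auto
      then show ?thesis by (simp add: W_def)
    qed
    finally show ?thesis using kwise_dists_prob_zeros[OF Q(1) J] by simp
  qed
  have W0: "pmf W {} = 0"
  proof -
    have "(\<lambda>\<omega>. {i. i < n \<and> \<not> \<omega> i}) -` {{}} = {\<omega>. \<forall>i<n. \<omega> i}" by auto
    then show ?thesis using Q(2) by (simp add: W_def pmf_map)
  qed
  show ?thesis
  proof (cases "even k")
    case True
    then obtain m where m: "k = 2 * m" by blast
    have "real m \<le> (real (card {..<n}) - 1) * (1 - p)"
      by (rule card_mult_ge_if_moments_even[of _ _ "pmf W"]) (use p moment m W0 in auto)
    then have "real m / (1 - p) \<le> real n - 1" using p by (simp add: pos_divide_le_eq)
    moreover have "real k / (2 * (1 - p)) = real m / (1 - p)"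
      unfolding m of_nat_mult of_nat_numeral by (rule mult_divide_mult_cancel_left) simp
    ultimately show ?thesis using True by simp
  next
    case False
    \<comment> \<open>Moments up to order \<open>k = 2 * m + 1\<close> are those of order below
      \<open>2 * (m + 1)\<close>, so the odd case is applied with
      \<open>m + 1 = (k + 1) / 2\<close>.\<close>
    then obtain m where m: "k = 2 * m + 1" by (elim oddE)
    have "real (m + 1) \<le> real (card {..<n}) * (1 - p)"
      by (rule card_mult_ge_if_moments_odd[of _ _ "pmf W"]) (use p moment m W0 in auto)
    then have "real (m + 1) / (1 - p) \<le> real n" using p by (simp add: pos_divide_le_eq)
    moreover have "(real k + 1) / (2 * (1 - p)) = real (m + 1) / (1 - p)"
    proof -
      have "real k + 1 = 2 * real (m + 1)" using m by simp
      then show ?thesis by (simp only: mult_divide_mult_cancel_left)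
    qed
    ultimately show ?thesis using False by simp
  qed
qed

theorem theorem27:
  shows "(\<forall>(p::real) (k::nat). 1/2 \<le> p \<and> p < 1 \<and> 0 < k \<longrightarrow>
            ereal (if even k then real k / (2 * (1 - p)) + 1 else (real k + 1) / (2 * (1 - p)))
              \<le> ereal_of_enat (n_c k p)) \<and>
         (\<exists>C::real. 0 < C \<and>
            (\<forall>(p::real) (q::nat) (k::nat). primepow q \<and> 1 - p = 1 / real q \<and> 0 < k \<longrightarrow>
               ereal_of_enat (n_c k p) \<le> ereal (C * (real k / (1 - p)) * ln (1 / (1 - p)))))"
proof (intro conjI allI impI exI[of _ "10 :: real"])
  fix p :: real and k :: nat
  assume pk: "1/2 \<le> p \<and> p < 1 \<and> 0 < k"
  define A where "A = {enat n | n. min_all_ones n k p = 0}"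
  show "ereal (if even k then real k / (2 * (1 - p)) + 1 else (real k + 1) / (2 * (1 - p)))
      \<le> ereal_of_enat (n_c k p)"
  \<comment> \<open>For empty \<open>A\<close> the critical number is \<infinity>; otherwise the
    infimum belongs to \<open>A\<close> by well-ordering.\<close>
  proof (cases "A = {}")
    case True
    then show ?thesis by (simp add: n_c_def A_def [symmetric] Inf_enat_def)
  next
    case False
    then have "Inf A \<in> A" using wellorder_InfI by blast
    then obtain n where "Inf A = enat n" "min_all_ones n k p = 0" by (auto simp: A_def)
    then show ?thesis
      using min_all_ones_eq_0_imp_ge[of p k n] pk
      by (simp only: n_c_def A_def [symmetric] ereal_of_enat_simps ereal_less_eq) simp
  qed
next
  fix p :: real and q k :: nat
  assume *: "primepow q \<and> 1 - p = 1 / real q \<and> 0 < k"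
  then have p: "p = 1 - 1 / real q" by simp
  have "2 \<le> q" using * primepow_gt_Suc_0[of q] by simp
  then show "ereal_of_enat (n_c k p) \<le> ereal (10 * (real k / (1 - p)) * ln (1 / (1 - p)))"
    using n_c_le[of q k] * by (simp add: p mult.assoc)
qed simp

end
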